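(* Let $c_1,c_2>0$. The two-parameter balanced metric on the Siegel--Jacobi upper half-plane $\mathcal{X}^J_1$, left-invariant with respect to the action of the reduced group $G^J(\mathbb{R})_0$, is given by the formulas $$ds^2_{\mathcal{X}^J_1}(\tau,z)=-c_1\frac{d\tau\, d\bar\tau}{(\tau-\bar\tau)^2}+\frac{2\mathrm{i}c_2}{\tau-\bar\tau}(dz-p\,d\tau)\times cc,\qquad p=\frac{z-\bar z}{\tau-\bar\tau},$$ $$ds^2_{\mathcal{X}^J_1}(x,y,p,q)=c_1\frac{dx^2+dy^2}{4y^2}+\frac{c_2}{y}\left[(x^2+y^2)dp^2+dq^2+2x\,dp\,dq\right]$$ $$=c_1\frac{dx^2+dy^2}{4y^2}+c_2\frac{x^2+y^2}{y}\left[\left(dp+\frac{x}{x^2+y^2}dq\right)^2+\left(\frac{y\,dq}{x^2+y^2}\right)^2\right],$$ $$ds^2_{\mathcal{X}^J_1}(x,y,\xi,\rho)=c_1\frac{dx^2+dy^2}{4y^2}+\frac{c_2}{y}\left[d\xi^2+d\rho^2+\left(\frac{\rho}{y}\right)^2(dx^2+dy^2)-2\frac{\rho}{y}(dx\,d\xi+dy\,d\rho)\right],$$ $$ds^2_{\mathcal{X}^J_1}(x,y,\chi,\psi)=c_1\frac{dx^2+dy^2}{4y^2}+\frac{c_2}{y}\left[(x\,d\psi+d\chi)^2+y^2d\psi^2\right].$$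
   Context: $\mathcal{X}^J_1\approx\{\tau\in\mathbb{C}:\mathrm{Im}\,\tau>0\}\times\mathbb{C}\ni(\tau,z)$, with coordinates $\tau=x+\mathrm{i}y$, $y>0$, and $z=p\tau+q=\xi+\mathrm{i}\rho$, where $x,y,p,q,\xi,\rho\in\mathbb{R}$ (so $\xi=px+q$, $\rho=py$). The coordinates $\chi,\psi\in\mathbb{R}$ are the real and imaginary parts of $\eta=\chi+\mathrm{i}\psi$ defined by $2\mathrm{i}z=(\tau+\mathrm{i})\eta-(\tau-\mathrm{i})\bar\eta$, so that $\chi=q$, $\psi=p$. "$\times cc$" means multiplication by the complex conjugate of the preceding factor in parentheses, $(dz-p\,d\tau)$. The reduced real Jacobi group $G^J(\mathbb{R})_0=\mathrm{SL}(2,\mathbb{R})\ltimes\mathbb{R}^2$ of pairs $(M,X)$, $M=\begin{pmatrix}a&b\\c&d\end{pmatrix}$, $X=(n,m)\in\mathbb{R}^2$, acts by $(M,X)\times(\tau',z')=\left(\frac{a\tau'+b}{c\tau'+d},\frac{z'+n\tau'+m}{c\tau'+d}\right)$; in the coordinates $(p,q)$, with $(p,q)=XM^{-1}$ denoting the corresponding parameters of the group element, $(p_1,q_1)=(p,q)+(p',q')M^{-1}$. The balanced metric is the Riemannian metric $\sum h_{\alpha\bar\beta}d\zeta_\alpha\otimes d\bar\zeta_\beta$, $\zeta=(\tau,z)$, associated with the Kähler two-form $\omega=\mathrm{i}\sum h_{\alpha\bar\beta}d\zeta_\alpha\wedge d\bar\zeta_\beta$ of Berndt--Kähler $$-\mathrm{i}\omega_{\mathcal{X}^J_1}=-\frac{c_1}{(\bar\tau-\tau)^2}d\tau\wedge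 d\bar\tau+\frac{2c_2}{\mathrm{i}(\bar\tau-\tau)}B\wedge\bar B,\qquad B=dz-\frac{z-\bar z}{\tau-\bar\tau}d\tau,$$ written with its two positive parameters normalized as $c_1,c_2$. *)

theory Defs
  imports "HOL-Analysis.Analysis"
begin

section \<open>Riemannian metrics on open subsets of a Euclidean space\<close>

text \<open>
  A tangent vector at a point of an open set is an element of the ambient vector space; a
  metric assigns to each point a real bilinear form.
  The classes below are meant for open \<open>S\<close>, where \<^const>\<open>frechet_derivative\<close> is the unique
  derivative. The space being finite-dimensional, continuity of all iterated directional
  derivatives is smoothness in the usual sense.
\<close>

primrec Ck_on :: "nat \<Rightarrow> 'a::euclidean_space set \<Rightarrow> ('a \<Rightarrow> real) \<Rightarrow> bool" where
  "Ck_on 0 S f \<longleftrightarrow> continuous_on S f"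
| "Ck_on (Suc k) S f \<longleftrightarrow>
     (\<forall>w\<in>S. f differentiable (at w)) \<and>
     (\<forall>v. Ck_on k S (\<lambda>w. frechet_derivative f (at w) v))"

definition smooth_on :: "'a::euclidean_space set \<Rightarrow> ('a \<Rightarrow> real) \<Rightarrow> bool" where
  "smooth_on S f \<longleftrightarrow> (\<forall>k. Ck_on k S f)"

definition riemannian_metric_on ::
    "'a::euclidean_space set \<Rightarrow> ('a \<Rightarrow> 'a \<Rightarrow> 'a \<Rightarrow> real) \<Rightarrow> bool" where
  "riemannian_metric_on S g \<longleftrightarrow>
     (\<forall>w\<in>S. bilinear (g w) \<and> (\<forall>u v. g w u v = g w v u) \<and> (\<forall>v. v \<noteq> 0 \<longrightarrow> 0 < g w v v)) \<and>
     (\<forall>u v. smooth_on S (\<lambda>w. g w u v))"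

definition pullback_metric ::
    "('a::euclidean_space \<Rightarrow> 'b::euclidean_space) \<Rightarrow> ('b \<Rightarrow> 'b \<Rightarrow> 'b \<Rightarrow> real) \<Rightarrow>
      'a \<Rightarrow> 'a \<Rightarrow> 'a \<Rightarrow> real" where
  "pullback_metric \<phi> g w u v =
     g (\<phi> w) (frechet_derivative \<phi> (at w) u) (frechet_derivative \<phi> (at w) v)"

definition line_element :: "('a \<Rightarrow> 'a \<Rightarrow> 'a \<Rightarrow> real) \<Rightarrow> 'a \<Rightarrow> 'a \<Rightarrow> real" where
  "line_element g w v = g w v v"

definition metric_preserving ::
    "'a::euclidean_space set \<Rightarrow> ('a \<Rightarrow> 'a \<Rightarrow> 'a \<Rightarrow> real) \<Rightarrow> ('a \<Rightarrow> 'a) \<Rightarrow> bool" where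
  "metric_preserving S g \<phi> \<longleftrightarrow>
     bij_betw \<phi> S S \<and>
     (\<forall>w\<in>S. \<phi> differentiable (at w) \<and> (\<forall>u v. pullback_metric \<phi> g w u v = g w u v))"


section \<open>The Siegel--Jacobi upper half-plane and the reduced Jacobi group\<close>

definition siegel_jacobi :: "(complex \<times> complex) set" where
  "siegel_jacobi = {(\<tau>, z). 0 < Im \<tau>}"

definition jacobi_group :: "((real^2^2) \<times> (real^2)) set" where
  "jacobi_group = {(M, X). det M = 1}"

definition jacobi_mult ::
    "(real^2^2) \<times> (real^2) \<Rightarrow> (real^2^2) \<times> (real^2) \<Rightarrow> (real^2^2) \<times> (real^2)" where
  "jacobi_mult g g' = (fst g ** fst g', snd g v* fst g' + snd g')"

definition jacobi_act ::
    "(real^2^2) \<times> (real^2) \<Rightarrow> complex \<times> complex \<Rightarrow> complex \<times> complex" where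
  "jacobi_act g w =
     (let M = fst g; X = snd g; \<tau> = fst w; z = snd w;
          j = of_real (M$2$1) * \<tau> + of_real (M$2$2)
      in ((of_real (M$1$1) * \<tau> + of_real (M$1$2)) / j,
          (z + of_real (X$1) * \<tau> + of_real (X$2)) / j))"

lemma jacobi_mult_closed:
  "g \<in> jacobi_group \<Longrightarrow> g' \<in> jacobi_group \<Longrightarrow> jacobi_mult g g' \<in> jacobi_group"
  by (auto simp: jacobi_group_def jacobi_mult_def det_mul)

lemma jacobi_denominator_nonzero:
  fixes M :: "real^2^2"
  assumes "det M = 1" "0 < Im \<tau>"
  shows "of_real (M$2$1) * \<tau> + of_real (M$2$2) \<noteq> (0::complex)"
  using assms by (auto simp: complex_eq_iff det_2)

lemma jacobi_act_mult:
  assumes "g \<in> jacobi_group" "g' \<in> jacobi_group" "w \<in> siegel_jacobi"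
  shows "jacobi_act (jacobi_mult g g') w = jacobi_act g (jacobi_act g' w)"
proof -
  obtain M X where g: "g = (M, X)" by (cases g)
  obtain M' X' where g': "g' = (M', X')" by (cases g')
  obtain \<tau> z where w: "w = (\<tau>, z)" by (cases w)
  have d: "det M' = 1" "det (M ** M') = 1" and t: "0 < Im \<tau>"
    using assms by (auto simp: g g' w jacobi_group_def siegel_jacobi_def det_mul)
  note nz = jacobi_denominator_nonzero[OF d(1) t] jacobi_denominator_nonzero[OF d(2) t]
  let ?j' = "of_real (M'$2$1) * \<tau> + of_real (M'$2$2) :: complex"
  let ?a = "of_real (M'$1$1) * \<tau> + of_real (M'$1$2) :: complex"
  have fractions: "k * (A / j) + l = (k * A + l * j) / j"
      "C / j + k * (A / j) + l = (C + k * A + l * j) / j"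
      "(A / j) / (D / j) = A / D"
    if "j \<noteq> 0" for k l A C D j :: complex
    using that by (simp_all add: add_divide_distrib)
  note frac = fractions[OF nz(1)]
  have eq: "of_real (M$i$1) * (?a / ?j') + of_real (M$i$2)
      = (of_real ((M ** M')$i$1) * \<tau> + of_real ((M ** M')$i$2)) / ?j'" for i
  proof -
    have "of_real ((M ** M')$i$1) * \<tau> + of_real ((M ** M')$i$2)
        = of_real (M$i$1) * ?a + of_real (M$i$2) * ?j'"
      by (simp add: matrix_matrix_mult_def sum_2 algebra_simps)
    thus ?thesis by (simp only: frac(1))
  qed
  have eq2: "(z + of_real (X'$1) * \<tau> + of_real (X'$2)) / ?j' + of_real (X$1) * (?a / ?j') + of_real (X$2)
      = (z + of_real ((X v* M' + X')$1) * \<tau> + of_real ((X v* M' + X')$2)) / ?j'"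
  proof -
    have "z + of_real ((X v* M' + X')$1) * \<tau> + of_real ((X v* M' + X')$2)
        = (z + of_real (X'$1) * \<tau> + of_real (X'$2)) + of_real (X$1) * ?a + of_real (X$2) * ?j'"
      by (simp add: vector_matrix_mult_def sum_2 algebra_simps)
    thus ?thesis by (simp only: frac(2))
  qed
  show ?thesis
    unfolding g g' w jacobi_act_def jacobi_mult_def Let_def fst_conv snd_conv eq eq2 frac(3) ..
qed


section \<open>The Berndt--Kaehler two-form and the balanced metric\<close>

type_synonym one_form = "complex \<times> complex \<Rightarrow> complex"
type_synonym two_form = "complex \<times> complex \<Rightarrow> complex \<times> complex \<Rightarrow> complex"

definition conj_form :: "one_form \<Rightarrow> one_form" where
  "conj_form \<alpha> v = cnj (\<alpha> v)"

definition wedge :: "one_form \<Rightarrow> one_form \<Rightarrow> two_form" where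
  "wedge \<alpha> \<beta> u v = \<alpha> u * \<beta> v - \<alpha> v * \<beta> u"

definition dtau :: one_form where "dtau v = fst v"
definition dz :: one_form where "dz v = snd v"

definition dzeta :: "2 \<Rightarrow> one_form" where
  "dzeta \<alpha> = (if \<alpha> = 1 then dtau else dz)"

definition B_form :: "complex \<times> complex \<Rightarrow> one_form" where
  "B_form w v = (case w of (\<tau>, z) \<Rightarrow> dz v - (z - cnj z) / (\<tau> - cnj \<tau>) * dtau v)"

text \<open>The classical formula gives \<open>- \<i> \<omega>\<close>, whence the leading factor \<open>\<i>\<close>.\<close>

definition berndt_kaehler_form :: "real \<Rightarrow> real \<Rightarrow> complex \<times> complex \<Rightarrow> two_form" where
  "berndt_kaehler_form c1 c2 w u v =
     (case w of (\<tau>, z) \<Rightarrow>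
       \<i> * (- (of_real c1 / (cnj \<tau> - \<tau>)\<^sup>2) * wedge dtau (conj_form dtau) u v
            + 2 * of_real c2 / (\<i> * (cnj \<tau> - \<tau>)) *
                wedge (B_form w) (conj_form (B_form w)) u v))"

definition hermitian_coeffs :: "two_form \<Rightarrow> complex^2^2 \<Rightarrow> bool" where
  "hermitian_coeffs \<omega> h \<longleftrightarrow>
     (\<forall>u v. \<omega> u v =
        \<i> * (\<Sum>\<alpha>\<in>UNIV. \<Sum>\<beta>\<in>UNIV. h$\<alpha>$\<beta> * wedge (dzeta \<alpha>) (conj_form (dzeta \<beta>)) u v))"

definition hermitian_form :: "complex^2^2 \<Rightarrow> two_form" where
  "hermitian_form h u v = (\<Sum>\<alpha>\<in>UNIV. \<Sum>\<beta>\<in>UNIV. h$\<alpha>$\<beta> * dzeta \<alpha> u * conj_form (dzeta \<beta>) v)"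

definition balanced_coeffs :: "real \<Rightarrow> real \<Rightarrow> complex \<times> complex \<Rightarrow> complex^2^2" where
  "balanced_coeffs c1 c2 w = (THE h. hermitian_coeffs (berndt_kaehler_form c1 c2 w) h)"

definition balanced_metric ::
    "real \<Rightarrow> real \<Rightarrow> complex \<times> complex \<Rightarrow> complex \<times> complex \<Rightarrow> complex \<times> complex \<Rightarrow> real" where
  "balanced_metric c1 c2 w u v = Re (hermitian_form (balanced_coeffs c1 c2 w) u v)"

text \<open>
  The coefficients exist uniquely, so the definite description above is legitimate, and
  they are Hermitian, so that \<^const>\<open>Re\<close> is exactly symmetrisation.
\<close>

lemma hermitian_coeffs_unique:
  assumes "hermitian_coeffs \<omega> h" "hermitian_coeffs \<omega> k"
  shows "h = k"
proof -
  have *: "(\<Sum>\<alpha>\<in>UNIV. \<Sum>\<beta>\<in>UNIV. h$\<alpha>$\<beta> * wedge (dzeta \<alpha>) (conj_form (dzeta \<beta>)) u v)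
     = (\<Sum>\<alpha>\<in>UNIV. \<Sum>\<beta>\<in>UNIV. k$\<alpha>$\<beta> * wedge (dzeta \<alpha>) (conj_form (dzeta \<beta>)) u v)"
    (is "?H = ?K") for u v
  proof -
    have "\<i> * ?H = \<omega> u v" "\<omega> u v = \<i> * ?K"
      by (rule assms(1)[unfolded hermitian_coeffs_def, rule_format, symmetric],
          rule assms(2)[unfolded hermitian_coeffs_def, rule_format])
    hence "\<i> * ?H = \<i> * ?K" by (rule trans)
    thus ?thesis by (simp only: mult_cancel_left complex_i_not_zero simp_thms)
  qed
  note simps = sum_2 dzeta_def dtau_def dz_def wedge_def conj_form_def
  have 1: "h$1$1 = k$1$1" using *[of "(1,0)" "(\<i>,0)"] by (simp add: simps)
  have 2: "h$2$2 = k$2$2" using *[of "(0,1)" "(0,\<i>)"] by (simp add: simps)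
  have 3: "h$1$2 - h$2$1 = k$1$2 - k$2$1" using *[of "(1,0)" "(0,1)"] by (simp add: simps)
  have "- \<i> * (h$1$2 + h$2$1) = - \<i> * (k$1$2 + k$2$1)"
    using *[of "(1,0)" "(0,\<i>)"] by (simp add: simps algebra_simps)
  hence 4: "h$1$2 + h$2$1 = k$1$2 + k$2$1" by simp
  have "2 * h$1$2 = (h$1$2 - h$2$1) + (h$1$2 + h$2$1)" by simp
  also have "\<dots> = 2 * k$1$2" unfolding 3 4 by simp
  finally have 5: "h$1$2 = k$1$2" by simp
  with 4 have "h$2$1 = k$2$1" by simp
  with 1 2 5 show ?thesis by (simp add: vec_eq_iff forall_2)
qed

lemma hermitian_coeffs_exist:
  assumes "w \<in> siegel_jacobi"
  shows "\<exists>h. hermitian_coeffs (berndt_kaehler_form c1 c2 w) h \<and> (\<forall>\<alpha> \<beta>. h$\<alpha>$\<beta> = cnj (h$\<beta>$\<alpha>))"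
proof -
  obtain \<tau> z where w: "w = (\<tau>, z)" by (cases w)
  define y where "y = Im \<tau>"
  have y: "y > 0" using assms by (simp add: w siegel_jacobi_def y_def)
  define p where "p = Im z / y"
  have tau: "\<tau> - cnj \<tau> = 2 * \<i> * of_real y" "cnj \<tau> - \<tau> = - (2 * \<i> * of_real y)"
    by (simp_all add: complex_eq_iff y_def)
  have p: "(z - cnj z) / (\<tau> - cnj \<tau>) = of_real p"
    using y by (simp add: tau p_def complex_eq_iff Re_divide Im_divide power2_eq_square field_simps)
  have c: "- (of_real c1 / (cnj \<tau> - \<tau>)\<^sup>2) = complex_of_real (c1 / (4 * y\<^sup>2))"
    "2 * of_real c2 / (\<i> * (cnj \<tau> - \<tau>)) = complex_of_real (c2 / y)"
    by (simp_all add: tau power_mult_distrib)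
  have B: "B_form (\<tau>, z) v = dz v - of_real p * dtau v" for v
    by (simp only: B_form_def prod.case p)
  define a b where "a = c1 / (4 * y\<^sup>2)" and "b = c2 / y"
  note c = c[folded a_def b_def]
  define h :: "complex^2^2" where "h = (\<chi> \<alpha> \<beta>. of_real
     (if \<alpha> = 1 then (if \<beta> = 1 then a + b * p\<^sup>2 else - (b * p))
      else (if \<beta> = 1 then - (b * p) else b)))"
  have h: "h$1$1 = of_real a + of_real b * (of_real p)\<^sup>2" "h$1$2 = - (of_real b * of_real p)"
    "h$2$1 = - (of_real b * of_real p)" "h$2$2 = of_real b"
    by (simp_all add: h_def)
  have "hermitian_coeffs (berndt_kaehler_form c1 c2 w) h"
    unfolding hermitian_coeffs_def berndt_kaehler_form_def w prod.case c
      sum_2 h wedge_def conj_form_def B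
    by (simp add: dzeta_def) algebra
  moreover have "\<forall>\<alpha> \<beta>. h$\<alpha>$\<beta> = cnj (h$\<beta>$\<alpha>)" by (simp add: h_def)
  ultimately show ?thesis by blast
qed


section \<open>Real coordinates\<close>

text \<open>Each system of real coordinates is given by its inverse chart, defined where \<open>y > 0\<close>.\<close>

type_synonym real4 = "real \<times> real \<times> real \<times> real"

definition chart_pq :: "real4 \<Rightarrow> complex \<times> complex" where
  "chart_pq = (\<lambda>(x, y, p, q).
     let \<tau> = of_real x + \<i> * of_real y in (\<tau>, of_real p * \<tau> + of_real q))"

definition chart_xi_rho :: "real4 \<Rightarrow> complex \<times> complex" where
  "chart_xi_rho = (\<lambda>(x, y, \<xi>, \<rho>).
     (of_real x + \<i> * of_real y, of_real \<xi> + \<i> * of_real \<rho>))"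

definition chart_chi_psi :: "real4 \<Rightarrow> complex \<times> complex" where
  "chart_chi_psi = (\<lambda>(x, y, chi, psi).
     let \<tau> = of_real x + \<i> * of_real y; \<eta> = of_real chi + \<i> * of_real psi
     in (\<tau>, ((\<tau> + \<i>) * \<eta> - (\<tau> - \<i>) * cnj \<eta>) / (2 * \<i>)))"

lemma chart_chi_psi_eq_chart_pq: "chart_chi_psi (x, y, chi, psi) = chart_pq (x, y, psi, chi)"
proof -
  let ?\<tau> = "of_real x + \<i> * of_real y" and ?\<eta> = "of_real chi + \<i> * of_real psi"
  have "(?\<tau> + \<i>) * ?\<eta> - (?\<tau> - \<i>) * cnj ?\<eta> = 2 * \<i> * (of_real psi * ?\<tau> + of_real chi)"
    by (simp add: complex_eq_iff algebra_simps)
  thus ?thesis by (simp add: chart_chi_psi_def chart_pq_def Let_def)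
qed

lemma chart_pq_eq_chart_xi_rho: "chart_pq (x, y, p, q) = chart_xi_rho (x, y, p * x + q, p * y)"
  by (simp add: chart_xi_rho_def chart_pq_def Let_def complex_eq_iff)

lemma bij_betw_chart_xi_rho: "bij_betw chart_xi_rho {(x, y, \<xi>, \<rho>). 0 < y} siegel_jacobi"
  by (rule bij_betw_byWitness[where f' = "\<lambda>(\<tau>, z). (Re \<tau>, Im \<tau>, Re z, Im z)"])
     (auto simp: chart_xi_rho_def siegel_jacobi_def complex_eq_iff)

lemma bij_betw_chart_pq: "bij_betw chart_pq {(x, y, p, q). 0 < y} siegel_jacobi"
  by (rule bij_betw_byWitness[where f' = "\<lambda>(\<tau>, z).
        (Re \<tau>, Im \<tau>, Im z / Im \<tau>, Re z - Im z / Im \<tau> * Re \<tau>)"])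
     (auto simp: chart_pq_def Let_def siegel_jacobi_def complex_eq_iff)

end

theory Submission
  imports Defs
begin

text \<open>
  Since \<open>h\<close> is Hermitian, the balanced metric is \<open>\<omega>(u, \<i> v) / 2\<close>, that is
  \<open>c\<^sub>1 / (4 y\<^sup>2) \<langle>d\<tau>, d\<tau>\<rangle> + c\<^sub>2 / y \<langle>B, B\<rangle>\<close> with \<open>B = dz - p d\<tau>\<close> and the Euclidean inner
  product of \<open>\<complex>\<close>. Under the action of \<open>(M, X)\<close> with \<open>j = c \<tau> + d\<close> the form \<open>d\<tau>\<close> is divided by
  \<open>j\<^sup>2\<close>, \<open>B\<close> is divided by \<open>j\<close> and \<open>y\<close> by \<open>\<bar>j\<bar>\<^sup>2\<close>, so both summands are invariant.
\<close>

section \<open>Smooth functions\<close>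

text \<open>At a point of an open set, differentiability and derivatives depend only on nearby
  values, so each step of the recursion sees only values on \<open>S\<close>. This is what allows a
  chosen \<open>frechet_derivative\<close> to be replaced by a formula valid just on
  \<open>S\<close>.\<close>

lemma Ck_on_cong:
  assumes "open S" "\<And>w. w \<in> S \<Longrightarrow> f w = g w"
  shows "Ck_on k S f \<longleftrightarrow> Ck_on k S g"
  using assms(2)
proof (induction k arbitrary: f g)
  case 0
  then show ?case by (auto intro: continuous_on_cong)
next
  case (Suc k)
  have imp: "f differentiable at w \<Longrightarrow> g differentiable at w"
    and eq: "frechet_derivative f (at w) = frechet_derivative g (at w)"
    if w: "w \<in> S" and fg: "\<And>w. w \<in> S \<Longrightarrow> f w = g w" for w and f g :: "'a \<Rightarrow> real"
  proof -
    \<comment> \<open>Exactly the same maps \<open>D\<close> are derivatives of both functions, so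
      the choice inside \<open>frechet_derivative\<close> selects the same map, differentiable or
      not.\<close>
    have *: "(f has_derivative D) (at w) \<longleftrightarrow> (g has_derivative D) (at w)" for D
      using has_derivative_transform_within_open[OF _ assms(1) w, of f D UNIV g]
        has_derivative_transform_within_open[OF _ assms(1) w, of g D UNIV f] fg by auto
    show "f differentiable at w \<Longrightarrow> g differentiable at w"
      using * by (auto simp: differentiable_def)
    show "frechet_derivative f (at w) = frechet_derivative g (at w)"
      by (simp add: frechet_derivative_def *)
  qed
  have "Ck_on k S (\<lambda>w. frechet_derivative f (at w) v) \<longleftrightarrow>
        Ck_on k S (\<lambda>w. frechet_derivative g (at w) v)" for v
    by (rule Suc.IH) (simp add: eq[OF _ Suc.prems])
  moreover have "(\<forall>w\<in>S. f differentiable at w) \<longleftrightarrow> (\<forall>w\<in>S. g differentiable at w)"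
    using imp[of _ f g] imp[of _ g f] Suc.prems by auto
  ultimately show ?case by simp
qed

lemma Ck_on_SucI:
  assumes "open S" "\<And>w. w \<in> S \<Longrightarrow> (f has_derivative f' w) (at w)"
    and "\<And>v. Ck_on k S (\<lambda>w. f' w v)"
  shows "Ck_on (Suc k) S f"
proof -
  have "Ck_on k S (\<lambda>w. frechet_derivative f (at w) v) \<longleftrightarrow> Ck_on k S (\<lambda>w. f' w v)" for v
    by (rule Ck_on_cong[OF assms(1)]) (simp add: frechet_derivative_at[OF assms(2), symmetric])
  moreover have "\<forall>w\<in>S. f differentiable at w"
    using assms(2) by (auto simp: differentiable_def)
  ultimately show ?thesis using assms(3) by simp
qed

lemma Ck_on_SucD:
  assumes "Ck_on (Suc k) S f"
  shows "w \<in> S \<Longrightarrow> (f has_derivative frechet_derivative f (at w)) (at w)"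
    and "Ck_on k S (\<lambda>w. frechet_derivative f (at w) v)"
  using assms by (auto simp: frechet_derivative_works)

text \<open>\<open>Ck_on (Suc k)\<close> speaks only of differentiability and of the derivatives, so
  the inclusion of the classes takes an induction, with continuity of differentiable functions at
  the bottom. The product and reciprocal rules need it because their derivatives still contain
  undifferentiated factors.\<close>

lemma Ck_on_Suc_imp: "Ck_on (Suc k) S f \<Longrightarrow> Ck_on k S f"
proof (induction k arbitrary: f)
  case 0
  then have "f differentiable_on S"
    by (simp add: differentiable_on_def differentiable_at_withinI)
  then show ?case
    by (simp add: differentiable_imp_continuous_on)
next
  case (Suc k)
  have "\<forall>w\<in>S. f differentiable at w" using Suc.prems by simp
  moreover have "Ck_on k S (\<lambda>w. frechet_derivative f (at w) v)" for v
    by (rule Suc.IH) (use Suc.prems in simp)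
  ultimately show ?case by simp
qed

section \<open>Closure properties of the classes C^k\<close>

lemma Ck_on_const:
  assumes "open S"
  shows "Ck_on k S (\<lambda>w. c)"
proof (induction k arbitrary: c)
  case (Suc k)
  show ?case
    by (rule Ck_on_SucI[where f' = "\<lambda>_ _. 0", OF assms]) (simp_all add: Suc.IH)
qed simp

text \<open>The derivative at every point is \<open>f\<close> itself, so all directional derivatives
  are constants.\<close>

lemma Ck_on_bounded_linear:
  assumes "open S" "bounded_linear f"
  shows "Ck_on k S f"
proof (cases k)
  case 0
  then show ?thesis using linear_continuous_on[OF assms(2)] by simp
next
  case (Suc n)
  show ?thesis
    unfolding Suc
    by (rule Ck_on_SucI[where f' = "\<lambda>_. f", OF assms(1)])
      (simp_all add: bounded_linear_imp_has_derivative assms Ck_on_const)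
qed

lemma Ck_on_add:
  assumes "open S"
  shows "Ck_on k S f \<Longrightarrow> Ck_on k S g \<Longrightarrow> Ck_on k S (\<lambda>w. f w + g w)"
proof (induction k arbitrary: f g)
  case 0
  then show ?case by (simp add: continuous_on_add)
next
  case (Suc k)
  note f = Ck_on_SucD[OF Suc.prems(1)] and g = Ck_on_SucD[OF Suc.prems(2)]
  show ?case
    by (rule Ck_on_SucI[where f' = "\<lambda>w v. frechet_derivative f (at w) v + frechet_derivative g (at w) v",
          OF assms])
      (simp_all only: has_derivative_add f g Suc.IH)
qed

lemma Ck_on_mult:
  assumes "open S"
  shows "Ck_on k S f \<Longrightarrow> Ck_on k S g \<Longrightarrow> Ck_on k S (\<lambda>w. f w * g w)"
proof (induction k arbitrary: f g)
  case 0
  then show ?case by (simp add: continuous_on_mult)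
next
  case (Suc k)
  note f = Ck_on_SucD[OF Suc.prems(1)] and g = Ck_on_SucD[OF Suc.prems(2)]
  show ?case
    by (rule Ck_on_SucI[where f' = "\<lambda>w v. f w * frechet_derivative g (at w) v
            + frechet_derivative f (at w) v * g w", OF assms])
      (simp_all only: has_derivative_mult f g Ck_on_add[OF assms] Suc.IH
        Ck_on_Suc_imp[OF Suc.prems(1)] Ck_on_Suc_imp[OF Suc.prems(2)])
qed

text \<open>The derivative of 1/f is the product of -1, f' and two copies of 1/f. The latter is of
  class k by the induction hypothesis for the same \<open>f\<close>.\<close>

lemma Ck_on_inverse:
  assumes "open S" "\<And>w. w \<in> S \<Longrightarrow> f w \<noteq> 0"
  shows "Ck_on k S f \<Longrightarrow> Ck_on k S (\<lambda>w. inverse (f w))"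
proof (induction k)
  case 0
  then show ?case using assms(2) by (auto intro: continuous_on_inverse)
next
  case (Suc k)
  note f = Ck_on_SucD[OF Suc.prems]
  have inv: "Ck_on k S (\<lambda>w. inverse (f w))"
    using Suc by (blast intro: Ck_on_Suc_imp)
  show ?case
  proof (rule Ck_on_SucI[OF assms(1)])
    show "((\<lambda>w. inverse (f w)) has_derivative
        (\<lambda>v. (- 1) * (inverse (f w) * (frechet_derivative f (at w) v * inverse (f w))))) (at w)"
      if "w \<in> S" for w
      using Deriv.has_derivative_inverse[OF assms(2)[OF that] f(1)[OF that]] by (simp add: mult_ac)
    show "Ck_on k S (\<lambda>w. (- 1) * (inverse (f w) * (frechet_derivative f (at w) v * inverse (f w))))" for v
      by (intro Ck_on_mult[OF assms(1)] Ck_on_const[OF assms(1)] inv f(2))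
  qed
qed


section \<open>The balanced metric\<close>

text \<open>Both differences in \<open>B_form_def\<close> are 2i times an imaginary part, so their
  quotient is the real number p. As division by zero yields 0, this also covers points with Im tau =
  0.\<close>

lemma B_form_eq: "B_form w v = snd v - of_real (Im (snd w) / Im (fst w)) * fst v"
proof -
  have "x - cnj x = 2 * \<i> * of_real (Im x)" for x
    by (simp add: complex_eq_iff)
  then show ?thesis
    by (cases w) (simp add: B_form_def dz_def dtau_def)
qed

text \<open>For complex linear forms a, b, the wedge of a with the conjugate of b at (u, iv) is -i
  (a(u) cnj(b(v)) + a(v) cnj(b(u))). Summing against i h gives H(u, v) + H(v, u) for the form H with
  coefficients h, and this is 2 Re H(u, v) because h is Hermitian. The coefficients themselves never
  have to be computed.\<close>

lemma balanced_metric_eq_form: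
  assumes "w \<in> siegel_jacobi"
  shows "balanced_metric c1 c2 w u v =
    Re (berndt_kaehler_form c1 c2 w u (\<i> * fst v, \<i> * snd v)) / 2"
proof -
  obtain h where h: "hermitian_coeffs (berndt_kaehler_form c1 c2 w) h"
    and herm: "\<And>\<alpha> \<beta>. h$\<alpha>$\<beta> = cnj (h$\<beta>$\<alpha>)"
    using hermitian_coeffs_exist[OF assms] by blast
  have "balanced_coeffs c1 c2 w = h"
    unfolding balanced_coeffs_def using h hermitian_coeffs_unique by blast
  moreover have "Im (h$1$1) = 0" "Im (h$2$2) = 0"
    "Re (h$2$1) = Re (h$1$2)" "Im (h$2$1) = - Im (h$1$2)"
    using herm[of 1 1] herm[of 2 2] herm[of 2 1] by (auto simp: complex_eq_iff)
  moreover note h[unfolded hermitian_coeffs_def, rule_format, of u "(\<i> * fst v, \<i> * snd v)"]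
  ultimately show ?thesis
    by (simp add: balanced_metric_def hermitian_form_def sum_2 wedge_def conj_form_def
        dzeta_def dtau_def dz_def algebra_simps)
qed

lemma balanced_metric_eq:
  assumes "w \<in> siegel_jacobi"
  shows "balanced_metric c1 c2 w u v =
    c1 / (4 * (Im (fst w))\<^sup>2) * (fst u \<bullet> fst v)
    + c2 / Im (fst w) * (B_form w u \<bullet> B_form w v)"
proof -
  obtain \<tau> z where w: "w = (\<tau>, z)" by (cases w)
  let ?v = "(\<i> * fst v, \<i> * snd v)"
  have tau: "cnj \<tau> - \<tau> = - (2 * \<i> * of_real (Im \<tau>))"
    by (simp add: complex_eq_iff)
  have c: "- (of_real c1 / (cnj \<tau> - \<tau>)\<^sup>2) = complex_of_real (c1 / (4 * (Im \<tau>)\<^sup>2))"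
    "2 * of_real c2 / (\<i> * (cnj \<tau> - \<tau>)) = complex_of_real (c2 / Im \<tau>)"
    by (simp_all add: tau power_mult_distrib)
  \<comment> \<open>For a form with a(iv) = i a(v), the wedge with its conjugate at (u, iv) is -2i
    times the inner product of a(u) and a(v). The factors i and 1/2 then cancel. Both
    \<open>dtau\<close> and \<open>B_form w\<close> satisfy the condition.\<close>
  have wedge: "Re (\<i> * (of_real a * wedge \<alpha> (conj_form \<alpha>) u ?v + of_real b * wedge \<beta> (conj_form \<beta>) u ?v)) / 2
      = a * (\<alpha> u \<bullet> \<alpha> v) + b * (\<beta> u \<bullet> \<beta> v)"
    if "\<alpha> ?v = \<i> * \<alpha> v" "\<beta> ?v = \<i> * \<beta> v" for a b \<alpha> \<beta>
    by (simp add: wedge_def conj_form_def that inner_complex_def algebra_simps)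
  have "balanced_metric c1 c2 w u v =
      c1 / (4 * (Im \<tau>)\<^sup>2) * (dtau u \<bullet> dtau v) + c2 / Im \<tau> * (B_form w u \<bullet> B_form w v)"
    unfolding balanced_metric_eq_form[OF assms] unfolding w berndt_kaehler_form_def prod.case c
    by (rule wedge) (simp_all add: dtau_def B_form_eq algebra_simps)
  then show ?thesis by (simp add: w dtau_def)
qed

lemma line_element_balanced_metric:
  assumes "w \<in> siegel_jacobi"
  shows "line_element (balanced_metric c1 c2) w v =
    c1 / (4 * (Im (fst w))\<^sup>2) * (cmod (fst v))\<^sup>2 + c2 / Im (fst w) * (cmod (B_form w v))\<^sup>2"
  by (simp add: line_element_def balanced_metric_eq[OF assms] dot_square_norm)

lemma open_siegel_jacobi: "open siegel_jacobi"
proof -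
  have "siegel_jacobi = {w. 0 < Im (fst w)}"
    by (auto simp: siegel_jacobi_def)
  moreover have "open {w :: complex \<times> complex. 0 < Im (fst w)}"
    by (intro open_Collect_less continuous_intros)
  ultimately show ?thesis by simp
qed

lemma linear_B_form: "linear (B_form w)"
  by (rule linearI) (simp_all add: B_form_eq algebra_simps scaleR_conv_of_real add_divide_distrib)

lemma riemannian_metric_on_balanced_metric:
  assumes "0 < c1" "0 < c2"
  shows "riemannian_metric_on siegel_jacobi (balanced_metric c1 c2)"
  unfolding riemannian_metric_on_def
proof (intro conjI ballI allI impI)
  fix w u v assume w: "w \<in> siegel_jacobi"
  have "bilinear (\<lambda>u v. a * (fst u \<bullet> fst v) + b * (B_form w u \<bullet> B_form w v))" for a b
    unfolding bilinear_def
    by (intro conjI allI linearI)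
      (simp_all add: linear_add[OF linear_B_form] linear_scale[OF linear_B_form]
        inner_add_left inner_add_right algebra_simps)
  from this[of "c1 / (4 * (Im (fst w))\<^sup>2)" "c2 / Im (fst w)"]
  show "bilinear (balanced_metric c1 c2 w)"
    by (simp only: balanced_metric_eq[OF w, abs_def])
  show "balanced_metric c1 c2 w u v = balanced_metric c1 c2 w v u"
    by (simp add: balanced_metric_eq[OF w] inner_commute)
next
  fix w v assume w: "w \<in> siegel_jacobi" and v: "v \<noteq> (0 :: complex \<times> complex)"
  have y: "0 < Im (fst w)" using w by (auto simp: siegel_jacobi_def)
  \<comment> \<open>The two forms have no common kernel: where \<open>fst v\<close> vanishes,
    \<open>B_form w v\<close> is just \<open>snd v\<close>.\<close>
  have "fst v \<noteq> 0 \<or> B_form w v \<noteq> 0"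
    using v by (auto simp: B_form_eq prod_eq_iff)
  then show "0 < balanced_metric c1 c2 w v v"
    using y assms
    by (auto simp: balanced_metric_eq[OF w] intro: add_pos_nonneg add_nonneg_pos)
next
  fix u v
  have S: "open siegel_jacobi" by (rule open_siegel_jacobi)
  let ?y = "\<lambda>w :: complex \<times> complex. inverse (Im (fst w))"
  let ?p = "\<lambda>w :: complex \<times> complex. Im (snd w) * ?y w"
  \<comment> \<open>These two identities turn the metric with fixed \<open>u\<close> and
    \<open>v\<close> into a polynomial in 1/y and Im z with constant coefficients, so smoothness
    follows from sums, products and one reciprocal.\<close>
  have coeffs: "c1 / (4 * y\<^sup>2) * s + c2 / y * r
      = c1 / 4 * s * (inverse y * inverse y) + c2 * inverse y * r" for y s r
    by (simp add: power2_eq_square field_simps)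
  have quadratic: "(b - of_real r * a) \<bullet> (b' - of_real r * a')
      = b \<bullet> b' + (- (a \<bullet> b') - b \<bullet> a') * r + (a \<bullet> a') * (r * r)" for a b a' b' :: complex and r
    by (simp add: inner_complex_def algebra_simps)
  have "Ck_on k siegel_jacobi (\<lambda>w. balanced_metric c1 c2 w u v)" for k
  proof -
    have im: "Ck_on k siegel_jacobi (\<lambda>w. Im (fst w))" "Ck_on k siegel_jacobi (\<lambda>w. Im (snd w))"
      by (auto intro!: Ck_on_bounded_linear[OF S] bounded_linear_compose[OF bounded_linear_Im]
          bounded_linear_fst bounded_linear_snd)
    have y: "Ck_on k siegel_jacobi ?y"
      by (rule Ck_on_inverse[OF S _ im(1)]) (auto simp: siegel_jacobi_def)
    note intros = Ck_on_add[OF S] Ck_on_mult[OF S] Ck_on_const[OF S] y im(2)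
    have "Ck_on k siegel_jacobi (\<lambda>w. c1 / 4 * (fst u \<bullet> fst v) * (?y w * ?y w)
        + c2 * ?y w * (snd u \<bullet> snd v + (- (fst u \<bullet> snd v) - snd u \<bullet> fst v) * ?p w
            + (fst u \<bullet> fst v) * (?p w * ?p w)))" (is "Ck_on k _ ?G")
      by (intro intros)
    then show ?thesis
    proof (rule iffD2[OF Ck_on_cong[OF S], rotated])
      fix w assume w: "w \<in> siegel_jacobi"
      have "B_form w u \<bullet> B_form w v = snd u \<bullet> snd v + (- (fst u \<bullet> snd v) - snd u \<bullet> fst v) * ?p w
          + (fst u \<bullet> fst v) * (?p w * ?p w)"
        unfolding B_form_eq divide_inverse by (rule quadratic)
      then show "balanced_metric c1 c2 w u v = ?G w"
        by (simp only: balanced_metric_eq[OF w] coeffs)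
    qed
  qed
  then show "smooth_on siegel_jacobi (\<lambda>w. balanced_metric c1 c2 w u v)"
    by (simp add: smooth_on_def)
qed


section \<open>Invariance under the reduced Jacobi group\<close>

text \<open>Multiplying numerator and denominator by the conjugate of the denominator makes the
  latter real; the numerator then has imaginary part (ad - bc) Im tau.\<close>

lemma Im_moebius:
  assumes "a * d - b * c = (1::real)"
  shows "Im ((of_real a * \<tau> + of_real b) / (of_real c * \<tau> + of_real d))
    = Im \<tau> / (cmod (of_real c * \<tau> + of_real d))\<^sup>2"
proof -
  have "Im ((of_real a * \<tau> + of_real b) * cnj (of_real c * \<tau> + of_real d)) = (a * d - b * c) * Im \<tau>"
    by (simp add: algebra_simps)
  then show ?thesis
    by (simp add: assms Im_complex_div_gt_0 complex_div_cnj[of "_ + _"] del: complex_cnj_add)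
qed

section \<open>The group acts by bijections of the half-plane\<close>

lemma jacobi_act_closed:
  assumes "g \<in> jacobi_group" "w \<in> siegel_jacobi"
  shows "jacobi_act g w \<in> siegel_jacobi"
proof -
  obtain M X where g: "g = (M, X)" by (cases g)
  obtain \<tau> z where w: "w = (\<tau>, z)" by (cases w)
  have d: "det M = 1" and t: "0 < Im \<tau>"
    using assms by (auto simp: g w jacobi_group_def siegel_jacobi_def)
  show ?thesis
    using t jacobi_denominator_nonzero[OF d t] d
    by (simp add: g w jacobi_act_def siegel_jacobi_def Let_def Im_moebius det_2)
qed

lemma jacobi_group_inverse:
  assumes "g \<in> jacobi_group"
  obtains g' where "g' \<in> jacobi_group"
    "jacobi_mult g g' = (mat 1, 0)" "jacobi_mult g' g = (mat 1, 0)"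
proof -
  obtain M X where g: "g = (M, X)" by (cases g)
  have d: "det M = 1" using assms by (simp add: g jacobi_group_def)
  then have "invertible M" by (simp add: invertible_det_nz)
  then obtain N where N: "M ** N = mat 1" "N ** M = mat 1" by (auto simp: invertible_def)
  have "det N = 1" using arg_cong[OF N(1), of det] d by (simp add: det_mul)
  moreover have "(- (X v* N)) v* M = - ((X v* N) v* M)"
    by (simp add: vector_matrix_mult_def vec_eq_iff sum_negf)
  then have "(- (X v* N)) v* M = - X"
    by (simp add: vector_matrix_mul_assoc N)
  \<comment> \<open>The vector part X' of the inverse is forced by \<open>X v* N + X' = 0\<close>;
    the identity just shown makes the product in the other order trivial as well.\<close>
  ultimately show ?thesis
    by (intro that[of "(N, - (X v* N))"]) (auto simp: g jacobi_group_def jacobi_mult_def N)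
qed

lemma jacobi_act_one: "jacobi_act (mat 1, 0) w = w"
  by (simp add: jacobi_act_def mat_def)

text \<open>By \<open>jacobi_act_mult\<close>, a two-sided inverse in the group acts as a two-sided
  inverse map.\<close>

lemma bij_betw_jacobi_act:
  assumes "g \<in> jacobi_group"
  shows "bij_betw (jacobi_act g) siegel_jacobi siegel_jacobi"
proof -
  obtain g' where "g' \<in> jacobi_group"
    "jacobi_mult g g' = (mat 1, 0)" "jacobi_mult g' g = (mat 1, 0)"
    using assms by (rule jacobi_group_inverse)
  then show ?thesis
    using assms jacobi_act_mult[of g g'] jacobi_act_mult[of g' g]
    by (intro bij_betw_byWitness[where f' = "jacobi_act g'"])
      (auto simp: jacobi_act_one intro: jacobi_act_closed)
qed

section \<open>Scaling of dtau and B under the action\<close>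

lemma inner_divide_complex: "(a / j) \<bullet> (b / j) = (a \<bullet> b) / (cmod j)\<^sup>2" for a b j :: complex
proof -
  have inner: "x \<bullet> y = Re (x * cnj y)" for x y
    by (simp add: inner_complex_def)
  \<comment> \<open>Division by \<open>j\<close> is conformal: in a cnj(b) it produces only the
    positive real factor 1/|j|^2, which passes through the real part.\<close>
  have "(a / j) * cnj (b / j) = a * cnj b / of_real ((cmod j)\<^sup>2)"
    by (simp only: complex_cnj_divide times_divide_times_eq complex_norm_square)
  then show ?thesis
    by (simp only: inner Re_divide_of_real)
qed

text \<open>Since p and q are real, taking imaginary parts recovers p = Im z / Im tau. The
  p-coordinate of a point can thus be read off from any real affine relation between z and
  tau.\<close>

lemma B_form_affine:
  assumes "Im (fst w) \<noteq> 0" "snd w = of_real p * fst w + of_real q"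
  shows "B_form w v = snd v - of_real p * fst v"
  using assms by (simp add: B_form_eq)

text \<open>This is the quotient rule in both components; the determinant condition simplifies the
  first numerator. The second is left expanded because it only becomes simple after p dtau is
  subtracted at the image point.\<close>

lemma jacobi_act_has_derivative:
  fixes M :: "real^2^2" and X :: "real^2" and \<tau> z :: complex
  assumes "det M = 1" "0 < Im \<tau>"
  defines "j \<equiv> of_real (M$2$1) * \<tau> + of_real (M$2$2)"
  shows "(jacobi_act (M, X) has_derivative
     (\<lambda>u. (fst u / j\<^sup>2,
        ((snd u + of_real (X$1) * fst u) * j
          - (z + of_real (X$1) * \<tau> + of_real (X$2)) * (of_real (M$2$1) * fst u)) / j\<^sup>2)))
     (at (\<tau>, z))"
proof -
  define a b c d where "a = complex_of_real (M$1$1)" and "b = complex_of_real (M$1$2)"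
    and "c = complex_of_real (M$2$1)" and "d = complex_of_real (M$2$2)"
  define n m where "n = complex_of_real (X$1)" and "m = complex_of_real (X$2)"
  note defs = a_def[symmetric] b_def[symmetric] c_def[symmetric] d_def[symmetric]
    n_def[symmetric] m_def[symmetric]
  have j: "j = c * \<tau> + d" "j \<noteq> 0"
    using jacobi_denominator_nonzero[OF assms(1,2)] by (simp_all add: j_def c_def d_def)
  have "a * d - b * c = complex_of_real (det M)"
    by (simp add: det_2 a_def b_def c_def d_def)
  then have det: "a * d = 1 + b * c"
    using assms(1) by (simp add: algebra_simps)
  have num: "((\<lambda>w. a * fst w + b) has_derivative (\<lambda>u. a * fst u)) (at (\<tau>, z))"
    and num': "((\<lambda>w. snd w + n * fst w + m) has_derivative (\<lambda>u. snd u + n * fst u)) (at (\<tau>, z))"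
    and den: "((\<lambda>w. c * fst w + d) has_derivative (\<lambda>u. c * fst u)) (at (\<tau>, z))"
    by (auto intro!: derivative_eq_intros)
  have nz: "c * fst (\<tau>, z) + d \<noteq> 0" using j by simp
  have "(jacobi_act (M, X) has_derivative
     (\<lambda>u. ((a * fst u * j - (a * \<tau> + b) * (c * fst u)) / (j * j),
        ((snd u + n * fst u) * j - (z + n * \<tau> + m) * (c * fst u)) / (j * j)))) (at (\<tau>, z))"
    using has_derivative_Pair[OF has_derivative_divide'[OF num den nz] has_derivative_divide'[OF num' den nz]]
    by (simp add: jacobi_act_def[abs_def] Let_def defs j(1))
  moreover have "a * x * j - (a * \<tau> + b) * (c * x) = x" for x
  proof -
    have "a * x * j - (a * \<tau> + b) * (c * x) = (a * d - b * c) * x"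
      by (simp add: j(1) algebra_simps)
    then show ?thesis by (simp add: det)
  qed
  ultimately show ?thesis by (simp add: power2_eq_square defs)
qed

text \<open>The \<open>(p, q)\<close>-coordinates of the image point are \<open>(p + n, q + m) M\<^sup>-\<^sup>1\<close>.\<close>

lemma B_form_jacobi_act:
  fixes M :: "real^2^2" and X :: "real^2" and \<tau> z :: complex
  assumes "det M = 1" and t: "0 < Im \<tau>"
  defines "j \<equiv> of_real (M$2$1) * \<tau> + of_real (M$2$2)"
  shows "B_form (jacobi_act (M, X) (\<tau>, z)) (frechet_derivative (jacobi_act (M, X)) (at (\<tau>, z)) u)
    = B_form (\<tau>, z) u / j"
proof -
  define p q where "p = Im z / Im \<tau>" and "q = Re z - p * Re \<tau>"
  have z: "z = of_real p * \<tau> + of_real q"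
    using t by (simp add: complex_eq_iff p_def q_def)
  define a b c d n m where "a = M$1$1" and "b = M$1$2" and "c = M$2$1" and "d = M$2$2"
    and "n = X$1" and "m = X$2"
  note defs = a_def[symmetric] b_def[symmetric] c_def[symmetric] d_def[symmetric]
    n_def[symmetric] m_def[symmetric]
  \<comment> \<open>These are the entries of (p + n, q + m) times the inverse of M, whose rows are
    (d, -b) and (-c, a) as det M = 1.\<close>
  define P Q where "P = (p + n) * d - (q + m) * c" and "Q = (q + m) * a - (p + n) * b"
  have j: "j = of_real c * \<tau> + of_real d" "j \<noteq> 0"
    using jacobi_denominator_nonzero[OF assms(1,2)] by (simp_all add: j_def c_def d_def)
  have det: "a * d - b * c = 1"
    using assms(1) by (simp add: det_2 defs)
  have act: "jacobi_act (M, X) (\<tau>, z)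
      = ((of_real a * \<tau> + of_real b) / j, (z + of_real n * \<tau> + of_real m) / j)"
    by (simp add: jacobi_act_def Let_def j(1) defs)
  \<comment> \<open>Multiplying (P, Q) by M gives back (p + n, q + m) up to the determinant. After
    division by \<open>j\<close>, this exhibits P as the p-coordinate of the image point.\<close>
  have "of_real P * (of_real a * \<tau> + of_real b) + of_real Q * j
      = of_real (a * d - b * c) * (z + of_real n * \<tau> + of_real m)"
    by (simp add: P_def Q_def j(1) z algebra_simps)
  then have num: "z + of_real n * \<tau> + of_real m = of_real P * (of_real a * \<tau> + of_real b) + of_real Q * j"
    by (simp add: det)
  have "snd (jacobi_act (M, X) (\<tau>, z)) = of_real P * fst (jacobi_act (M, X) (\<tau>, z)) + of_real Q"
    unfolding act fst_conv snd_conv num using j(2)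
    by (simp add: add_divide_distrib distrib_left)
  moreover have "Im (fst (jacobi_act (M, X) (\<tau>, z))) \<noteq> 0"
    using t j Im_moebius[OF det, of \<tau>] by (simp add: act)
  moreover note frechet_derivative_at[OF jacobi_act_has_derivative[OF assms(1,2), of X z], symmetric]
  ultimately have "B_form (jacobi_act (M, X) (\<tau>, z)) (frechet_derivative (jacobi_act (M, X)) (at (\<tau>, z)) u)
      = ((snd u + of_real n * fst u) * j - (z + of_real n * \<tau> + of_real m) * (of_real c * fst u)
          - of_real P * fst u) / j\<^sup>2"
    by (simp add: B_form_affine defs j(1) diff_divide_distrib)
  \<comment> \<open>The terms in n, m and q cancel and the coefficient of \<open>fst u\<close>
    collapses to -p j, so one factor of j^2 is lost.\<close>
  also have "(snd u + of_real n * fst u) * j - (z + of_real n * \<tau> + of_real m) * (of_real c * fst u)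
          - of_real P * fst u = (snd u - of_real p * fst u) * j"
    by (simp add: P_def j(1) z algebra_simps)
  also have "snd u - of_real p * fst u = B_form (\<tau>, z) u"
    using t z by (simp add: B_form_affine)
  finally show ?thesis
    using j(2) by (simp add: power2_eq_square)
qed

lemma metric_preserving_jacobi_act:
  assumes "g \<in> jacobi_group"
  shows "metric_preserving siegel_jacobi (balanced_metric c1 c2) (jacobi_act g)"
  unfolding metric_preserving_def
proof (intro conjI ballI allI)
  show "bij_betw (jacobi_act g) siegel_jacobi siegel_jacobi"
    by (rule bij_betw_jacobi_act[OF assms])
next
  fix w u v assume w: "w \<in> siegel_jacobi"
  obtain M X where g: "g = (M, X)" by (cases g)
  obtain \<tau> z where w': "w = (\<tau>, z)" by (cases w)
  have d: "det M = 1" and t: "0 < Im \<tau>"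
    using assms w by (auto simp: g w' jacobi_group_def siegel_jacobi_def)
  define j where "j = of_real (M$2$1) * \<tau> + of_real (M$2$2)"
  note der = jacobi_act_has_derivative[OF d t, of X z, folded j_def]
  show "jacobi_act g differentiable at w"
    using der by (auto simp: g w' differentiable_def)
  have nz: "cmod j \<noteq> 0"
    using jacobi_denominator_nonzero[OF d t] by (simp add: j_def)
  have Im: "Im (fst (jacobi_act g w)) = Im \<tau> / (cmod j)\<^sup>2"
    using d by (simp add: g w' jacobi_act_def Let_def Im_moebius det_2 j_def)
  have fst: "fst (frechet_derivative (jacobi_act g) (at w) u) = fst u / j\<^sup>2" for u
    by (simp add: g w' frechet_derivative_at[OF der, symmetric])
  have B: "B_form (jacobi_act g w) (frechet_derivative (jacobi_act g) (at w) u) = B_form w u / j" for u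
    by (simp add: g w' B_form_jacobi_act[OF d t] j_def)
  \<comment> \<open>With k = |j|, the first summand carries k^4 from 1/y^2 against k^4 from the two
    copies of dtau; the second carries k^2 from 1/y against k^2 from the two copies of B.\<close>
  have scale: "C / (4 * (Im \<tau> / k\<^sup>2)\<^sup>2) * (s / (k\<^sup>2)\<^sup>2) + D / (Im \<tau> / k\<^sup>2) * (r / k\<^sup>2)
      = C / (4 * (Im \<tau>)\<^sup>2) * s + D / Im \<tau> * r" if "k \<noteq> 0" for C D k r s :: real
    using that t by (simp add: field_simps)
  show "pullback_metric (jacobi_act g) (balanced_metric c1 c2) w u v = balanced_metric c1 c2 w u v"
    unfolding pullback_metric_def balanced_metric_eq[OF w]
      balanced_metric_eq[OF jacobi_act_closed[OF assms w]] Im fst B inner_divide_complex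
    unfolding norm_power scale[OF nz] by (simp add: w')
qed


section \<open>The metric in real coordinates\<close>

lemma frechet_derivative_chart_pq:
  "frechet_derivative chart_pq (at (x, y, p, q)) (dx, dy, dp, dq) =
    (Complex dx dy, of_real dp * Complex x y + of_real p * Complex dx dy + of_real dq)"
proof -
  have eq: "chart_pq = (\<lambda>w. (of_real (fst w) + \<i> * of_real (fst (snd w)),
      of_real (fst (snd (snd w))) * (of_real (fst w) + \<i> * of_real (fst (snd w)))
        + of_real (snd (snd (snd w)))))"
    by (auto simp: chart_pq_def Let_def fun_eq_iff)
  have "(chart_pq has_derivative (\<lambda>v. (of_real (fst v) + \<i> * of_real (fst (snd v)),
      of_real p * (of_real (fst v) + \<i> * of_real (fst (snd v)))
        + of_real (fst (snd (snd v))) * (of_real x + \<i> * of_real y)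
        + of_real (snd (snd (snd v)))))) (at (x, y, p, q))"
    unfolding eq by (auto intro!: derivative_eq_intros)
  from frechet_derivative_at[OF this, symmetric] show ?thesis
    by (simp add: Complex_eq)
qed

text \<open>The chart is real linear, hence its own derivative at every point.\<close>

lemma frechet_derivative_chart_xi_rho:
  "frechet_derivative chart_xi_rho (at w) (dx, dy, d\<xi>, d\<rho>) = (Complex dx dy, Complex d\<xi> d\<rho>)"
proof -
  have eq: "chart_xi_rho = (\<lambda>w. (of_real (fst w) + \<i> * of_real (fst (snd w)),
      of_real (fst (snd (snd w))) + \<i> * of_real (snd (snd (snd w)))))"
    by (auto simp: chart_xi_rho_def fun_eq_iff)
  have "(chart_xi_rho has_derivative chart_xi_rho) (at w)"
    unfolding eq by (auto intro!: derivative_eq_intros)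
  from frechet_derivative_at[OF this, symmetric] show ?thesis
    by (simp add: chart_xi_rho_def Complex_eq)
qed

text \<open>Because chi = q and psi = p, the two charts differ by exchanging the last two
  coordinates, and so do their derivatives.\<close>

lemma frechet_derivative_chart_chi_psi:
  "frechet_derivative chart_chi_psi (at (x, y, chi, psi)) (dx, dy, dchi, dpsi) =
    frechet_derivative chart_pq (at (x, y, psi, chi)) (dx, dy, dpsi, dchi)"
proof -
  have eq: "chart_chi_psi = (\<lambda>w. (of_real (fst w) + \<i> * of_real (fst (snd w)),
      of_real (snd (snd (snd w))) * (of_real (fst w) + \<i> * of_real (fst (snd w)))
        + of_real (fst (snd (snd w)))))"
    by (auto simp: chart_chi_psi_eq_chart_pq chart_pq_def Let_def fun_eq_iff)
  have "(chart_chi_psi has_derivative (\<lambda>v. (of_real (fst v) + \<i> * of_real (fst (snd v)),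
      of_real psi * (of_real (fst v) + \<i> * of_real (fst (snd v)))
        + of_real (snd (snd (snd v))) * (of_real x + \<i> * of_real y)
        + of_real (fst (snd (snd v)))))) (at (x, y, chi, psi))"
    unfolding eq by (auto intro!: derivative_eq_intros)
  from frechet_derivative_at[OF this, symmetric] show ?thesis
    by (simp add: frechet_derivative_chart_pq Complex_eq)
qed

section \<open>Line elements in the charts\<close>

lemma line_element_chart_pq:
  assumes "0 < y"
  shows "line_element (pullback_metric chart_pq (balanced_metric c1 c2)) (x, y, p, q) (dx, dy, dp, dq) =
    c1 * (dx\<^sup>2 + dy\<^sup>2) / (4 * y\<^sup>2) + c2 / y * ((x * dp + dq)\<^sup>2 + y\<^sup>2 * dp\<^sup>2)"
proof -
  let ?w = "chart_pq (x, y, p, q)"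
  let ?v = "frechet_derivative chart_pq (at (x, y, p, q)) (dx, dy, dp, dq)"
  have w: "?w \<in> siegel_jacobi" and Im: "Im (fst ?w) = y"
    using assms by (auto simp: chart_pq_def siegel_jacobi_def Let_def)
  have "B_form ?w ?v = snd ?v - of_real p * fst ?v"
    using assms by (intro B_form_affine[where q = q]) (auto simp: chart_pq_def Let_def)
  \<comment> \<open>From dz = p dtau + tau dp + dq, the form B pulls back to tau dp + dq, here split
    into real and imaginary parts.\<close>
  then have "B_form ?w ?v = Complex (x * dp + dq) (y * dp)"
    by (simp add: frechet_derivative_chart_pq complex_eq_iff)
  moreover have "fst ?v = Complex dx dy"
    by (simp add: frechet_derivative_chart_pq)
  ultimately show ?thesis
    using line_element_balanced_metric[OF w, of c1 c2 ?v]
    by (simp add: line_element_def pullback_metric_def Im cmod_power2 power_mult_distrib)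
qed

lemma line_element_chart_chi_psi:
  "line_element (pullback_metric chart_chi_psi g) (x, y, chi, psi) (dx, dy, dchi, dpsi) =
    line_element (pullback_metric chart_pq g) (x, y, psi, chi) (dx, dy, dpsi, dchi)"
  by (simp add: line_element_def pullback_metric_def frechet_derivative_chart_chi_psi
      chart_chi_psi_eq_chart_pq)

lemma line_element_chart_xi_rho:
  assumes "0 < y"
  shows "line_element (pullback_metric chart_xi_rho (balanced_metric c1 c2)) (x, y, \<xi>, \<rho>) (dx, dy, d\<xi>, d\<rho>) =
    c1 * (dx\<^sup>2 + dy\<^sup>2) / (4 * y\<^sup>2)
    + c2 / y * (d\<xi>\<^sup>2 + d\<rho>\<^sup>2 + (\<rho> / y)\<^sup>2 * (dx\<^sup>2 + dy\<^sup>2) - 2 * (\<rho> / y) * (dx * d\<xi> + dy * d\<rho>))"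
proof -
  let ?w = "chart_xi_rho (x, y, \<xi>, \<rho>)" and ?v = "(Complex dx dy, Complex d\<xi> d\<rho>)"
  have w: "?w \<in> siegel_jacobi"
    and Im: "Im (fst ?w) = y" "Im (snd ?w) = \<rho>"
    using assms by (auto simp: chart_xi_rho_def siegel_jacobi_def)
  \<comment> \<open>This is the coordinate p expressed through rho and y, so B becomes (d\<xi> - r
    dx) + i (d\<rho> - r dy), and its squared modulus is expanded below.\<close>
  define r where "r = \<rho> / y"
  have "B_form ?w ?v = Complex (d\<xi> - r * dx) (d\<rho> - r * dy)"
    unfolding B_form_eq Im r_def[symmetric] by (simp add: complex_eq_iff)
  moreover have "(d\<xi> - r * dx)\<^sup>2 + (d\<rho> - r * dy)\<^sup>2
      = d\<xi>\<^sup>2 + d\<rho>\<^sup>2 + r\<^sup>2 * (dx\<^sup>2 + dy\<^sup>2) - 2 * r * (dx * d\<xi> + dy * d\<rho>)"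
    by (simp add: power2_eq_square algebra_simps)
  ultimately show ?thesis
    using line_element_balanced_metric[OF w, of c1 c2 ?v]
    by (simp add: line_element_def pullback_metric_def frechet_derivative_chart_xi_rho Im cmod_power2
        r_def)
qed

text \<open>Since tau - cnj tau = 2iy, the square in the first denominator is -4y^2, which absorbs
  the minus sign, and 2i/(2iy) = 1/y. Both complex coefficients are therefore the real ones.\<close>

lemma line_element_balanced_metric_complex:
  assumes "0 < Im \<tau>"
  shows "complex_of_real (line_element (balanced_metric c1 c2) (\<tau>, z) v) =
    - of_real c1 * (dtau v * cnj (dtau v)) / (\<tau> - cnj \<tau>)\<^sup>2
    + 2 * \<i> * of_real c2 / (\<tau> - cnj \<tau>) * (B_form (\<tau>, z) v * cnj (B_form (\<tau>, z) v))"
proof -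
  have w: "(\<tau>, z) \<in> siegel_jacobi" using assms by (simp add: siegel_jacobi_def)
  have "\<tau> - cnj \<tau> = 2 * \<i> * of_real (Im \<tau>)"
    by (simp add: complex_eq_iff)
  then show ?thesis
    by (simp add: line_element_balanced_metric[OF w] dtau_def power_mult_distrib
        flip: complex_norm_square)
qed

theorem proposition3:
  fixes c1 c2 :: real
  assumes "0 < c1" and "0 < c2"
  shows
    "riemannian_metric_on siegel_jacobi (balanced_metric c1 c2) \<and>
     (\<forall>g\<in>jacobi_group. metric_preserving siegel_jacobi (balanced_metric c1 c2) (jacobi_act g)) \<and>
     (\<forall>\<tau> z v. 0 < Im \<tau> \<longrightarrow>
        (let p = (z - cnj z) / (\<tau> - cnj \<tau>) in
         complex_of_real (line_element (balanced_metric c1 c2) (\<tau>, z) v) =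
           - of_real c1 * (dtau v * cnj (dtau v)) / (\<tau> - cnj \<tau>)\<^sup>2
           + 2 * \<i> * of_real c2 / (\<tau> - cnj \<tau>) *
               ((dz v - p * dtau v) * cnj (dz v - p * dtau v)))) \<and>
     (\<forall>x y p q dx dy dp dq. 0 < y \<longrightarrow>
        line_element (pullback_metric chart_pq (balanced_metric c1 c2))
            (x, y, p, q) (dx, dy, dp, dq) =
          c1 * (dx\<^sup>2 + dy\<^sup>2) / (4 * y\<^sup>2)
          + c2 / y * ((x\<^sup>2 + y\<^sup>2) * dp\<^sup>2 + dq\<^sup>2 + 2 * x * dp * dq) \<and>
        line_element (pullback_metric chart_pq (balanced_metric c1 c2))
            (x, y, p, q) (dx, dy, dp, dq) =
          c1 * (dx\<^sup>2 + dy\<^sup>2) / (4 * y\<^sup>2)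
          + c2 * ((x\<^sup>2 + y\<^sup>2) / y) *
              ((dp + x / (x\<^sup>2 + y\<^sup>2) * dq)\<^sup>2 + (y * dq / (x\<^sup>2 + y\<^sup>2))\<^sup>2)) \<and>
     (\<forall>x y \<xi> \<rho> dx dy d\<xi> d\<rho>. 0 < y \<longrightarrow>
        line_element (pullback_metric chart_xi_rho (balanced_metric c1 c2))
            (x, y, \<xi>, \<rho>) (dx, dy, d\<xi>, d\<rho>) =
          c1 * (dx\<^sup>2 + dy\<^sup>2) / (4 * y\<^sup>2)
          + c2 / y * (d\<xi>\<^sup>2 + d\<rho>\<^sup>2 + (\<rho> / y)\<^sup>2 * (dx\<^sup>2 + dy\<^sup>2)
                      - 2 * (\<rho> / y) * (dx * d\<xi> + dy * d\<rho>))) \<and>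
     (\<forall>x y chi psi dx dy dchi dpsi. 0 < y \<longrightarrow>
        line_element (pullback_metric chart_chi_psi (balanced_metric c1 c2))
            (x, y, chi, psi) (dx, dy, dchi, dpsi) =
          c1 * (dx\<^sup>2 + dy\<^sup>2) / (4 * y\<^sup>2)
          + c2 / y * ((x * dpsi + dchi)\<^sup>2 + y\<^sup>2 * dpsi\<^sup>2))"
proof (intro conjI allI impI ballI)
  show "riemannian_metric_on siegel_jacobi (balanced_metric c1 c2)"
    by (rule riemannian_metric_on_balanced_metric[OF assms])
  show "metric_preserving siegel_jacobi (balanced_metric c1 c2) (jacobi_act g)"
    if "g \<in> jacobi_group" for g
    by (rule metric_preserving_jacobi_act[OF that])
  show "let p = (z - cnj z) / (\<tau> - cnj \<tau>) in
         complex_of_real (line_element (balanced_metric c1 c2) (\<tau>, z) v) =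
           - of_real c1 * (dtau v * cnj (dtau v)) / (\<tau> - cnj \<tau>)\<^sup>2
           + 2 * \<i> * of_real c2 / (\<tau> - cnj \<tau>) *
               ((dz v - p * dtau v) * cnj (dz v - p * dtau v))"
    if "0 < Im \<tau>" for \<tau> z v
    \<comment> \<open>The quotient bound to \<open>p\<close> is the one in
      \<open>B_form_def\<close>, so the factor dz - p dtau is literally B.\<close>
    using line_element_balanced_metric_complex[OF that] by (simp only: B_form_def prod.case Let_def)
next
  fix x y p q dx dy dp dq :: real assume y: "0 < y"
  let ?ds = "line_element (pullback_metric chart_pq (balanced_metric c1 c2))
    (x, y, p, q) (dx, dy, dp, dq)"
  \<comment> \<open>Both sides are the squared modulus of tau dp + dq, the right one fully
    expanded.\<close>
  have eq: "(x * dp + dq)\<^sup>2 + y\<^sup>2 * dp\<^sup>2 = (x\<^sup>2 + y\<^sup>2) * dp\<^sup>2 + dq\<^sup>2 + 2 * x * dp * dq"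
    by (simp add: power2_eq_square algebra_simps)
  then show "?ds = c1 * (dx\<^sup>2 + dy\<^sup>2) / (4 * y\<^sup>2)
      + c2 / y * ((x\<^sup>2 + y\<^sup>2) * dp\<^sup>2 + dq\<^sup>2 + 2 * x * dp * dq)"
    by (simp add: line_element_chart_pq[OF y])
  define r where "r = x\<^sup>2 + y\<^sup>2"
  have r: "r \<noteq> 0" using y by (simp add: r_def sum_power2_eq_zero_iff)
  \<comment> \<open>The square in dp is completed with r = |tau|^2: the two dq^2 terms combine to
    (x^2 + y^2)/r = 1, and the result is again the squared modulus of tau dp + dq.\<close>
  have "r * ((dp + x / r * dq)\<^sup>2 + (y * dq / r)\<^sup>2)
      = r * dp\<^sup>2 + 2 * x * dp * dq + (x\<^sup>2 + y\<^sup>2) * dq\<^sup>2 / r"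
    using r by (simp add: power2_eq_square field_simps)
  also have "\<dots> = (x * dp + dq)\<^sup>2 + y\<^sup>2 * dp\<^sup>2"
    using r by (simp add: eq r_def)
  finally have "c2 / y * ((x * dp + dq)\<^sup>2 + y\<^sup>2 * dp\<^sup>2)
      = c2 * (r / y) * ((dp + x / r * dq)\<^sup>2 + (y * dq / r)\<^sup>2)"
    by simp
  then show "?ds = c1 * (dx\<^sup>2 + dy\<^sup>2) / (4 * y\<^sup>2) + c2 * ((x\<^sup>2 + y\<^sup>2) / y) *
      ((dp + x / (x\<^sup>2 + y\<^sup>2) * dq)\<^sup>2 + (y * dq / (x\<^sup>2 + y\<^sup>2))\<^sup>2)"
    by (simp only: line_element_chart_pq[OF y] r_def)
qed (simp_all add: line_element_chart_xi_rho line_element_chart_chi_psi line_element_chart_pq)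

end
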